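(* Let $K_1\subset\mathbb{R}$ be a compact set with $|K_1|=0$ and let $[c,d]$ be the smallest closed interval containing $K_1$. Let $\mu_1$ be a (positive, finite Borel) measure on $\mathbb{R}$ with support equal to $K_1$ and $\mu_1(K_1)=2L$. Then there exists a compact set $K_0\subset\mathbb{R}$ with $|K_0|=2L$ such that the solution $\rho(\cdot,t)$, $0\le t<1$, of the one-dimensional aggregation equation $$\rho_t+(\rho v)_x=0,\qquad v(\cdot,t)=-N_x*\rho(\cdot,t),\qquad \rho(\cdot,0)=\chi_{K_0},\qquad N(x)=\tfrac12|x|,$$ satisfies $$\rho(x,t)\,\mathrm{d}x\longrightarrow \mathrm{d}\mu_1\quad\text{weakly as } t\to1^-.$$
   Context: $|A|$ denotes the Lebesgue measure of $A\subset\mathbb{R}$ and $\chi_A$ its characteristic function. $K_1$ is nonempty (so that $[c,d]$ makes sense). Here $N_x(x)=\frac12\operatorname{sign}(x)$, so that $v(x,t)=\frac12\int_x^{\infty}\rho(y,t)\,\mathrm{d}y-\frac12\int_{-\infty}^x\rho(y,t)\,\mathrm{d}y$. The flow map $X(\cdot,t)$ of $v$ is defined by $\frac{\mathrm{d}}{\mathrm{d}t}X(\alpha,t)=v(X(\alpha,t),t)$, $X(\alpha,0)=\alpha$; for $0\le t<1$ it is a homeomorphism of $\mathbb{R}$. The solution $\rho$ of the equation with bounded compactly supported initial datum $\rho_0$ is the one given along the flow map by $\rho(X(\alpha,t),t)=\frac{\rho_0(\alpha)}{1-t\rho_0(\alpha)}$; for $\rho_0=\chi_{K_0}$ this reads $\rho(\cdot,t)=\frac{1}{1-t}\chi_{K_t}$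 with $K_t=X(K_0,t)$, $0\le t<1$. Weak convergence of measures $\mu_t\to\mu_1$ means $\int g\,\mathrm{d}\mu_t\to\int g\,\mathrm{d}\mu_1$ for every continuous function $g$ on $\mathbb{R}$. *)

theory Defs
  imports "HOL-Analysis.Analysis"
begin

definition newton_potential :: "real \<Rightarrow> real" where
  "newton_potential x = \<bar>x\<bar> / 2"

text \<open>The derivative of the potential, with the convention that it vanishes at the origin.\<close>

definition newton_potential_x :: "real \<Rightarrow> real" where
  "newton_potential_x x = sgn x / 2"

lemma newton_potential_has_derivative:
  assumes "x \<noteq> 0"
  shows "(newton_potential has_real_derivative newton_potential_x x) (at x)"
proof -
  have "((\<lambda>y. sgn x * y / 2) has_real_derivative sgn x / 2) (at x)"
    by (auto intro!: derivative_eq_intros)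
  then have "((\<lambda>y. \<bar>y\<bar> / 2) has_real_derivative sgn x / 2) (at x)"
    by (rule has_field_derivative_transform_within[where d = "\<bar>x\<bar>"])
      (use assms in \<open>auto simp: sgn_if dist_real_def\<close>)
  then show ?thesis
    by (simp add: newton_potential_def[abs_def] newton_potential_x_def)
qed

text \<open>Densities, velocities and flows are curried as space first, time second.
  The velocity is minus the spatial convolution of \<open>newton_potential_x\<close> with the density.\<close>

definition velocity :: "(real \<Rightarrow> real \<Rightarrow> real) \<Rightarrow> real \<Rightarrow> real \<Rightarrow> real" where
  "velocity \<rho> x t = - (\<integral>y. newton_potential_x (x - y) * \<rho> y t \<partial>lborel)"

lemma velocity_eq:
  assumes "integrable lborel (\<lambda>y. \<rho> y t)"
  shows "velocity \<rho> x t =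
    (1/2) * (\<integral>y\<in>{x..}. \<rho> y t \<partial>lborel) - (1/2) * (\<integral>y\<in>{..x}. \<rho> y t \<partial>lborel)"
proof -
  have i: "set_integrable lborel A (\<lambda>y. \<rho> y t)" if "A \<in> sets lborel" for A
    using assms that unfolding set_integrable_def
    by (intro integrable_mult_indicator) auto
  have "(\<integral>y. newton_potential_x (x - y) * \<rho> y t \<partial>lborel) =
    (\<integral>y. (1/2) * (indicat_real {..x} y *\<^sub>R \<rho> y t) - (1/2) * (indicat_real {x..} y *\<^sub>R \<rho> y t) \<partial>lborel)"
    by (intro Bochner_Integration.integral_cong)
      (auto simp: newton_potential_x_def indicator_def sgn_if)
  also have "\<dots> = (1/2) * (\<integral>y\<in>{..x}. \<rho> y t \<partial>lborel) - (1/2) * (\<integral>y\<in>{x..}. \<rho> y t \<partial>lborel)"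
    using i[of "{..x}"] i[of "{x..}"]
    unfolding set_integrable_def set_lebesgue_integral_def
    by (subst Bochner_Integration.integral_diff) auto
  finally show ?thesis
    by (simp add: velocity_def)
qed

text \<open>The equation \<open>\<rho>\<^sub>t + (\<rho> v)\<^sub>x = 0\<close> on \<open>[0,T)\<close> in the weak sense: tested against
  continuously differentiable, compactly supported functions of the space variable, with the
  derivative in time taken one-sidedly at time \<open>0\<close>.\<close>

definition weak_continuity_equation ::
  "real \<Rightarrow> (real \<Rightarrow> real \<Rightarrow> real) \<Rightarrow> (real \<Rightarrow> real \<Rightarrow> real) \<Rightarrow> bool" where
  "weak_continuity_equation T \<rho> v \<longleftrightarrow>
    (\<forall>\<phi> :: real \<Rightarrow> real. \<phi> differentiable_on UNIV \<longrightarrow> continuous_on UNIV (deriv \<phi>) \<longrightarrow>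
      compact (closure {x. \<phi> x \<noteq> 0}) \<longrightarrow>
      (\<forall>t\<in>{0..<T}. ((\<lambda>s. \<integral>x. \<phi> x * \<rho> x s \<partial>lborel) has_real_derivative
        (\<integral>x. deriv \<phi> x * (\<rho> x t * v x t) \<partial>lborel)) (at t within {0..<T})))"

definition flow_map :: "real \<Rightarrow> (real \<Rightarrow> real \<Rightarrow> real) \<Rightarrow> (real \<Rightarrow> real \<Rightarrow> real) \<Rightarrow> bool" where
  "flow_map T v X \<longleftrightarrow>
    (\<forall>\<alpha>. X \<alpha> 0 = \<alpha> \<and>
      (\<forall>t\<in>{0..<T}. (X \<alpha> has_real_derivative v (X \<alpha> t) t) (at t within {0..<T})))"

text \<open>The solution on \<open>[0,T)\<close> with bounded, compactly supported initial datum \<open>\<rho>0\<close>: besides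
  solving the equation, it is given by an explicit formula along the flow map of its own velocity
  field. The homeomorphism clause makes this formula determine \<open>\<lambda>x. \<rho> x t\<close> on all of \<open>\<real>\<close>.
  The definition is meant for \<open>T\<close> such that \<open>1 - t * \<rho>0 \<alpha> > 0\<close> for all \<open>t < T\<close>; this is
  the case for \<open>T = 1\<close> and \<open>\<rho>0\<close> a characteristic function.\<close>

definition aggregation_solution ::
  "real \<Rightarrow> (real \<Rightarrow> real) \<Rightarrow> (real \<Rightarrow> real \<Rightarrow> real) \<Rightarrow> bool" where
  "aggregation_solution T \<rho>0 \<rho> \<longleftrightarrow>
    (\<forall>x. \<rho> x 0 = \<rho>0 x) \<and>
    (\<forall>t\<in>{0..<T}. integrable lborel (\<lambda>x. \<rho> x t)) \<and>
    weak_continuity_equation T \<rho> (velocity \<rho>) \<and>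
    (\<exists>X. flow_map T (velocity \<rho>) X \<and>
      (\<forall>t\<in>{0..<T}. (\<exists>Y. homeomorphism UNIV UNIV (\<lambda>\<alpha>. X \<alpha> t) Y) \<and>
        (\<forall>\<alpha>. \<rho> (X \<alpha> t) t = \<rho>0 \<alpha> / (1 - t * \<rho>0 \<alpha>))))"

definition measure_support :: "'a::topological_space measure \<Rightarrow> 'a set" where
  "measure_support M = {x. \<forall>U. open U \<and> x \<in> U \<longrightarrow> emeasure M U > 0}"

text \<open>Test functions are all continuous functions, not only the bounded ones. Integrability is
  required explicitly because the Bochner integral of a non-integrable function is \<open>0\<close>.\<close>

definition weak_convergence ::
  "('b \<Rightarrow> real measure) \<Rightarrow> real measure \<Rightarrow> 'b filter \<Rightarrow> bool" where
  "weak_convergence \<mu> \<nu> F \<longleftrightarrow>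
    (\<forall>g :: real \<Rightarrow> real. continuous_on UNIV g \<longrightarrow>
      (\<forall>\<^sub>F t in F. integrable (\<mu> t) g) \<and> integrable \<nu> g \<and>
      ((\<lambda>t. \<integral>x. g x \<partial>\<mu> t) \<longlongrightarrow> (\<integral>x. g x \<partial>\<nu>)) F)"

end

theory Submission
  imports Defs "HOL-Probability.Distribution_Functions"
begin

text \<open>
  Let \<open>K\<close> be the initial patch and \<open>M a\<close> the length of \<open>K \<inter> (-\<infinity>, a]\<close>. Particles do not cross, so the mass to the left of
  each particle is conserved and the particle starting at \<open>a\<close> keeps the velocity \<open>|K|/2 - M a\<close>. The
  flow is therefore explicit, \<open>X(a,t) = a + t (|K|/2 - M a)\<close> (\<open>particle_path\<close>): for \<open>t < 1\<close> it is a
  homeomorphism with slope \<open>1 - t\<close> almost everywhere on \<open>K\<close> and \<open>1\<close> off \<open>K\<close>, so that \<open>\<rho>(x,t) dx\<close> is the image of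
  Lebesgue measure on \<open>K\<close> (\<open>density_eq_distr_particle_path\<close>). The paths extend continuously to
  \<open>t = 1\<close>, and by dominated convergence the weak limit is the image of the same measure under
  \<open>X(\<cdot>,1)\<close> (\<open>solution_weak_convergence_at_1\<close>).

  It remains to choose \<open>K\<close> so that this image is \<open>\<mu>1\<close>. In that case, if \<open>x = X(a,1)\<close> is not an
  atom, then \<open>M a = F x\<close> with the distribution function \<open>F\<close> of \<open>\<mu>1\<close>, and the formula for \<open>X\<close> gives
  \<open>a = x - L + F x\<close>. So \<open>X(\<cdot>,1)\<close> has to be the generalized inverse
  of the strictly increasing function \<open>x - L + F x\<close>; these two functions are \<open>collapse\<close> and \<open>spread\<close>.
  The generalized inverse pushes Lebesgue measure forward to the Stieltjes measure of \<open>spread\<close>, which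
  is Lebesgue measure plus \<open>\<mu>1\<close> (\<open>emeasure_collapse_vimage\<close>). The two summands are carried by the
  complement of \<open>K1\<close> and by \<open>K1\<close>, respectively. Hence, with \<open>K0\<close> the preimage of \<open>K1\<close> under \<open>collapse\<close>,
  Lebesgue measure on \<open>K0\<close> is pushed forward to \<open>\<mu>1\<close>, and this \<open>K0\<close> does have \<open>collapse\<close> as
  its flow map at time \<open>1\<close> (\<open>particle_path_1_eq_collapse\<close>).

  The convergence is claimed for every solution, so the flow of an arbitrary solution must be shown to
  be the explicit one (\<open>flow_eq_particle_path\<close>). Here conservation of the mass between two particles has
  to be proved. By the formula for \<open>\<rho>\<close> the velocity difference of two particles is minus the
  length of the image of \<open>K\<close> between them, divided by \<open>1 - t\<close>. Gaps of \<open>K\<close> thus keep their length, so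
  the distance of two particles and the length of the image of \<open>K\<close> between them differ by a
  constant. Both are then determined by a scalar linear differential equation.
\<close>

section \<open>The explicit flow of a patch\<close>

lemma borel_measure_eqI_Ioc:
  fixes M N :: "real measure"
  assumes "sets M = sets borel" "sets N = sets borel"
    and "\<And>a b. a \<le> b \<Longrightarrow> emeasure M {a<..b} = emeasure N {a<..b}"
    and "\<And>a b. emeasure M {a<..b} \<noteq> \<infinity>"
  shows "M = N"
proof (rule measure_eqI_generator_eq[where \<Omega> = UNIV and E = "range (\<lambda>(a, b). {a<..b})"
      and A = "\<lambda>i. {- real i<..real i}"])
  show "Int_stable (range (\<lambda>(a, b). {a<..b::real}))"
    by (auto simp: Int_stable_def greaterThanAtMost_def[symmetric])
next
  fix X assume "X \<in> range (\<lambda>(a, b). {a<..b::real})"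
  then obtain a b where X: "X = {a<..b}" by auto
  show "emeasure M X = emeasure N X"
  proof (cases "a \<le> b")
    case True then show ?thesis using assms(3) X by simp
  next
    case False then have "X = {}" using X by auto
    then show ?thesis by simp
  qed
next
  have "\<exists>i. - real i < x \<and> x \<le> real i" for x :: real
  proof -
    obtain i where "\<bar>x\<bar> < real i" using reals_Archimedean2 by blast
    then show ?thesis by (intro exI[of _ i]) auto
  qed
  then show "(\<Union>i. {- real i<..real i}) = UNIV" by auto
next
  show "emeasure M {- real i<..real i} \<noteq> \<infinity>" for i
    using assms(4) .
  show "sets M = sigma_sets UNIV (range (\<lambda>(a, b). {a<..b}))"
    "sets N = sigma_sets UNIV (range (\<lambda>(a, b). {a<..b}))"
    using assms(1,2) by (simp_all add: borel_sigma_sets_Ioc)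
qed auto

definition mass_below :: "real set \<Rightarrow> real \<Rightarrow> real" where
  "mass_below K a = measure lborel (K \<inter> {..a})"

text \<open>The name anticipates the result: the terms in parentheses are half the mass to the right minus half
  the mass to the left of \<open>a\<close> at time \<open>0\<close>. The formula makes sense at \<open>t = 1\<close>, where the flow of
  a solution is no longer defined.\<close>

definition particle_path :: "real set \<Rightarrow> real \<Rightarrow> real \<Rightarrow> real" where
  "particle_path K a t = a + t * (measure lborel K / 2 - mass_below K a)"

abbreviation patch :: "real set \<Rightarrow> real measure" where
  "patch K \<equiv> density lborel (\<lambda>x. ennreal (indicat_real K x))"

context
  fixes K :: "real set"
  assumes K: "compact K"
begin

lemma patch_set_borel [measurable]: "K \<in> sets borel"
  using K by (simp add: borel_compact)

lemma patch_set_fmeasurable: "K \<in> fmeasurable lborel"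
  using emeasure_compact_finite[OF K] by (intro fmeasurableI) (auto simp: patch_set_borel)

lemma mass_below_diff:
  assumes "a \<le> b"
  shows "mass_below K b - mass_below K a = measure lborel (K \<inter> {a<..b})"
proof -
  have "K \<inter> {..b} = (K \<inter> {..a}) \<union> (K \<inter> {a<..b})" using assms by auto
  moreover have "measure lborel ((K \<inter> {..a}) \<union> (K \<inter> {a<..b}))
      = measure lborel (K \<inter> {..a}) + measure lborel (K \<inter> {a<..b})"
    by (intro measure_Un_AE AE_I2 fmeasurable_Int_fmeasurable patch_set_fmeasurable) auto
  ultimately show ?thesis by (simp add: mass_below_def)
qed

lemma mass_below_mono: "a \<le> b \<Longrightarrow> mass_below K a \<le> mass_below K b"
  by (metis diff_ge_0_iff_ge mass_below_diff measure_nonneg)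

lemma mass_below_diff_le:
  assumes "a \<le> b" shows "mass_below K b - mass_below K a \<le> b - a"
proof -
  have "measure lborel (K \<inter> {a<..b}) \<le> measure lborel {a<..b}"
    by (intro measure_mono_fmeasurable fmeasurableI) (use assms in auto)
  then show ?thesis using mass_below_diff[OF assms] assms by simp
qed

lemma mass_below_nonneg: "0 \<le> mass_below K a"
  by (simp add: mass_below_def)

lemma mass_below_le: "mass_below K a \<le> measure lborel K"
  unfolding mass_below_def
  by (intro measure_mono_fmeasurable patch_set_fmeasurable) auto

lemma particle_path_diff_ge:
  assumes "a \<le> b" "0 \<le> t"
  shows "(1 - t) * (b - a) \<le> particle_path K b t - particle_path K a t"
  using mult_left_mono[OF mass_below_diff_le[OF assms(1)] assms(2)]
  by (simp add: particle_path_def algebra_simps)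

lemma particle_path_diff_le:
  assumes "a \<le> b" "0 \<le> t"
  shows "particle_path K b t - particle_path K a t \<le> b - a"
  using mult_left_mono[OF mass_below_mono[OF assms(1)] assms(2)]
  by (simp add: particle_path_def algebra_simps)

lemma particle_path_mono:
  assumes "0 \<le> t" "t \<le> 1" "a \<le> b"
  shows "particle_path K a t \<le> particle_path K b t"
  using particle_path_diff_ge[OF assms(3,1)] mult_nonneg_nonneg[of "1 - t" "b - a"] assms by linarith

lemma particle_path_less_iff:
  assumes "0 \<le> t" "t < 1"
  shows "particle_path K a t < particle_path K b t \<longleftrightarrow> a < b"
proof -
  have "particle_path K x t < particle_path K y t" if "x < y" for x y
    using particle_path_diff_ge[of x y t] mult_pos_pos[of "1 - t" "y - x"] that assms by linarith
  then show ?thesis using particle_path_mono[of t b a] assms by (meson le_less_trans linorder_not_le less_imp_le)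
qed

lemma particle_path_le_iff:
  assumes "0 \<le> t" "t < 1"
  shows "particle_path K a t \<le> particle_path K b t \<longleftrightarrow> a \<le> b"
  using particle_path_less_iff[OF assms] by (meson linorder_not_less)

lemma particle_path_inj:
  assumes "0 \<le> t" "t < 1"
  shows "inj (\<lambda>a. particle_path K a t)"
  by (rule injI) (use particle_path_le_iff[OF assms] in \<open>metis order_antisym order_refl\<close>)

lemma particle_path_dist:
  assumes "0 \<le> t" "t \<le> 1"
  shows "\<bar>particle_path K a t - particle_path K b t\<bar> \<le> \<bar>a - b\<bar>"
  using particle_path_diff_le[of a b t] particle_path_diff_le[of b a t]
    particle_path_mono[of t a b] particle_path_mono[of t b a] assms
  by (cases "a \<le> b") auto

lemma continuous_on_particle_path:
  assumes "0 \<le> t" "t \<le> 1"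
  shows "continuous_on S (\<lambda>a. particle_path K a t)"
  unfolding continuous_on_iff dist_real_def
  using particle_path_dist[OF assms] by (meson le_less_trans)

lemma particle_path_measurable:
  assumes "0 \<le> t" "t \<le> 1"
  shows "(\<lambda>a. particle_path K a t) \<in> borel_measurable borel"
  using continuous_on_particle_path[OF assms] by (rule borel_measurable_continuous_onI)

lemma particle_path_displacement:
  assumes "0 \<le> t" "t \<le> 1"
  shows "\<bar>particle_path K a t - a\<bar> \<le> measure lborel K"
proof -
  have "\<bar>measure lborel K / 2 - mass_below K a\<bar> \<le> measure lborel K"
    using mass_below_nonneg[of a] mass_below_le[of a] by linarith
  then have "\<bar>t * (measure lborel K / 2 - mass_below K a)\<bar> \<le> 1 * measure lborel K"
    unfolding abs_mult by (intro mult_mono) (use assms in auto)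
  then show ?thesis by (simp add: particle_path_def)
qed

lemma particle_path_surj:
  assumes "0 \<le> t" "t \<le> 1"
  obtains a where "particle_path K a t = y"
proof -
  let ?m = "measure lborel K"
  have "\<exists>a. y - ?m \<le> a \<and> a \<le> y + ?m \<and> particle_path K a t = y"
  proof (rule IVT')
    show "particle_path K (y - ?m) t \<le> y" using particle_path_displacement[OF assms, of "y - ?m"] by linarith
    show "y \<le> particle_path K (y + ?m) t" using particle_path_displacement[OF assms, of "y + ?m"] by linarith
  qed (auto intro: continuous_on_particle_path assms)
  then show ?thesis using that by blast
qed

lemma particle_path_homeomorphism:
  assumes t: "0 \<le> t" "t < 1"
  shows "\<exists>Y. homeomorphism UNIV UNIV (\<lambda>a. particle_path K a t) Y"
proof -
  have "range (\<lambda>a. particle_path K a t) = UNIV"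
    using particle_path_surj t by (metis less_imp_le surjI)
  then show ?thesis
    using injective_into_1d_eq_homeomorphism[of UNIV "\<lambda>a. particle_path K a t"]
      particle_path_inj[OF t] continuous_on_particle_path[of t UNIV] t
    by (auto simp: path_connected_UNIV)
qed

text \<open>The slope of the flow is \<open>1 - t\<close> almost everywhere on \<open>K\<close> and \<open>1\<close> off \<open>K\<close>. As the path is strictly increasing, this change
  of variables can be checked on intervals, where it says that \<open>mass_below K\<close> increases from
  \<open>a\<close> to \<open>b\<close> by the length of \<open>K\<close> between them.\<close>

lemma lborel_eq_distr_particle_path:
  assumes t: "0 \<le> t" "t < 1"
  shows "distr (density lborel (\<lambda>a. ennreal (1 - t * indicat_real K a))) borel
    (\<lambda>a. particle_path K a t) = lborel" (is "?D = _")
proof (rule borel_measure_eqI_Ioc)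
  have [measurable]: "(\<lambda>a. particle_path K a t) \<in> borel_measurable borel"
    using t by (intro particle_path_measurable) auto
  have Ioc: "emeasure ?D {x<..y} = emeasure lborel {x<..y}" if "x \<le> y" for x y
  proof -
    obtain a b where ab: "particle_path K a t = x" "particle_path K b t = y"
      using particle_path_surj t by (metis less_imp_le)
    have "a \<le> b" using that ab particle_path_le_iff[OF t] by blast
    have vim: "(\<lambda>a. particle_path K a t) -` {x<..y} = {a<..b}"
      using particle_path_le_iff[OF t] particle_path_less_iff[OF t] ab by auto
    have nn: "0 \<le> 1 - t * indicat_real K z" for z
      using t by (auto simp: indicator_def)
    have "emeasure ?D {x<..y} = (\<integral>\<^sup>+ z. ennreal (1 - t * indicat_real K z) * indicator {a<..b} z \<partial>lborel)"
      by (simp add: emeasure_distr vim emeasure_density)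
    also have "\<dots> = (\<integral>\<^sup>+ z. ennreal (indicat_real {a<..b} z - t * indicat_real (K \<inter> {a<..b}) z) \<partial>lborel)"
      by (intro nn_integral_cong) (auto simp: indicator_def)
    also have "\<dots> = ennreal (\<integral> z. indicat_real {a<..b} z - t * indicat_real (K \<inter> {a<..b}) z \<partial>lborel)"
    proof (rule nn_integral_eq_integral)
      have "K \<inter> {a<..b} \<in> fmeasurable lborel"
        by (intro fmeasurable_Int_fmeasurable patch_set_fmeasurable) auto
      then show "integrable lborel (\<lambda>z. indicat_real {a<..b} z - t * indicat_real (K \<inter> {a<..b}) z)"
        using \<open>a \<le> b\<close> by (intro Bochner_Integration.integrable_diff integrable_mult_right integrable_real_indicator)
          (auto simp: fmeasurable_def)
      show "AE z in lborel. 0 \<le> indicat_real {a<..b} z - t * indicat_real (K \<inter> {a<..b}) z"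
        using t by (auto simp: indicator_def)
    qed
    also have "(\<integral> z. indicat_real {a<..b} z - t * indicat_real (K \<inter> {a<..b}) z \<partial>lborel)
       = (b - a) - t * measure lborel (K \<inter> {a<..b})"
    proof -
      have "K \<inter> {a<..b} \<in> fmeasurable lborel"
        by (intro fmeasurable_Int_fmeasurable patch_set_fmeasurable) auto
      then show ?thesis
        using \<open>a \<le> b\<close> by (subst Bochner_Integration.integral_diff) (auto simp: fmeasurable_def)
    qed
    also have "\<dots> = y - x"
      using mass_below_diff[OF \<open>a \<le> b\<close>] ab by (simp add: particle_path_def algebra_simps flip: ab)
    finally show ?thesis using that by simp
  qed
  show "emeasure ?D {x<..y} = emeasure lborel {x<..y}" if "x \<le> y" for x y using Ioc that .
  show "emeasure ?D {x<..y} \<noteq> \<infinity>" for x y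
    using Ioc[of x y] by (cases "x \<le> y") auto
qed auto

text \<open>Multiplying the change of variables by \<open>r\<close> cancels the slope, since \<open>r\<close> is the indicator of \<open>K\<close>
  divided by the slope along the paths.\<close>

lemma density_eq_distr_particle_path:
  assumes t: "0 \<le> t" "t < 1"
    and r: "r \<in> borel_measurable borel"
    and along: "\<And>a. r (particle_path K a t) = indicat_real K a / (1 - t * indicat_real K a)"
  shows "density lborel (\<lambda>x. ennreal (r x)) = distr (patch K) borel (\<lambda>a. particle_path K a t)"
proof (rule measure_eqI)
  have [measurable]: "(\<lambda>a. particle_path K a t) \<in> borel_measurable borel"
    using t by (intro particle_path_measurable) auto
  note [measurable] = r
  fix A assume "A \<in> sets (density lborel (\<lambda>x. ennreal (r x)))"
  then have [measurable]: "A \<in> sets borel" by simp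
  let ?P = "\<lambda>a. particle_path K a t"
  have "emeasure (density lborel (\<lambda>x. ennreal (r x))) A = (\<integral>\<^sup>+ x. ennreal (r x) * indicator A x \<partial>lborel)"
    by (simp add: emeasure_density)
  also have "\<dots> = (\<integral>\<^sup>+ a. ennreal (1 - t * indicat_real K a) * (ennreal (r (?P a)) * indicator A (?P a)) \<partial>lborel)"
    by (subst lborel_eq_distr_particle_path[OF t, symmetric])
      (simp add: nn_integral_distr nn_integral_density)
  also have "\<dots> = (\<integral>\<^sup>+ a. ennreal (indicat_real K a) * indicator (?P -` A) a \<partial>lborel)"
    using t by (intro nn_integral_cong) (auto simp: along indicator_def simp flip: ennreal_mult)
  also have "\<dots> = emeasure (distr (patch K) borel ?P) A"
    using measurable_sets_borel[of ?P borel A] by (simp add: emeasure_distr emeasure_density)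
  finally show "emeasure (density lborel (\<lambda>x. ennreal (r x))) A = \<dots>" .
qed auto

end

section \<open>Existence of the patch solution\<close>

context
  fixes K :: "real set"
  assumes K: "compact K"
begin

lemma patch_finite_measure: "finite_measure (patch K)"
proof
  show "emeasure (patch K) (space (patch K)) \<noteq> \<infinity>"
    using emeasure_compact_finite[OF K] patch_set_borel[OF K]
    by (simp add: emeasure_density ennreal_indicator)
qed

lemma measure_patch:
  assumes "A \<in> sets borel"
  shows "measure (patch K) A = measure lborel (K \<inter> A)"
proof -
  have "emeasure (patch K) A = (\<integral>\<^sup>+ x. indicator (K \<inter> A) x \<partial>lborel)"
    using assms patch_set_borel[OF K]
    by (auto simp: emeasure_density indicator_def intro!: nn_integral_cong)
  then show ?thesis
    using assms patch_set_borel[OF K] by (simp add: measure_def)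
qed

lemma AE_patch: "AE x in patch K. x \<in> K"
  using patch_set_borel[OF K] by (subst AE_density) (auto simp: indicator_def)

lemma integrable_patch:
  fixes f :: "real \<Rightarrow> real"
  assumes "f \<in> borel_measurable borel" "\<And>x. x \<in> K \<Longrightarrow> \<bar>f x\<bar> \<le> B"
  shows "integrable (patch K) f"
  using AE_patch assms
  by (intro finite_measure.integrable_const_bound[OF patch_finite_measure, of _ B]) auto

text \<open>Integrals over Eulerian space become integrals over the initial patch.\<close>

lemma
  fixes g :: "real \<Rightarrow> real"
  assumes t: "0 \<le> t" "t < 1"
    and r: "r \<in> borel_measurable borel"
    and along: "\<And>a. r (particle_path K a t) = indicat_real K a / (1 - t * indicat_real K a)"
    and g: "g \<in> borel_measurable borel"
  shows integral_along_paths: "(\<integral>x. g x * r x \<partial>lborel) = (\<integral>a. g (particle_path K a t) \<partial>patch K)"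
    and integrable_along_paths: "integrable lborel (\<lambda>x. g x * r x) \<longleftrightarrow> integrable (patch K) (\<lambda>a. g (particle_path K a t))"
proof -
  have P: "(\<lambda>a. particle_path K a t) \<in> borel_measurable borel"
    using t by (intro particle_path_measurable[OF K]) auto
  have nonneg: "AE x in lborel. 0 \<le> r x"
  proof (rule AE_I2)
    fix x
    obtain a where "particle_path K a t = x" using particle_path_surj[OF K, of t x] t by auto
    then show "0 \<le> r x" using along[of a] t by (auto simp: indicator_def split: if_splits)
  qed
  show "(\<integral>x. g x * r x \<partial>lborel) = (\<integral>a. g (particle_path K a t) \<partial>patch K)"
    using integral_density[of g lborel r] integral_distr[of "\<lambda>a. particle_path K a t" "patch K" borel g]
      density_eq_distr_particle_path[OF K t r along] nonneg r g P
    by (simp add: mult.commute)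
  show "integrable lborel (\<lambda>x. g x * r x) \<longleftrightarrow> integrable (patch K) (\<lambda>a. g (particle_path K a t))"
    using integrable_density[of g lborel r] integrable_distr_eq[of "\<lambda>a. particle_path K a t" "patch K" borel g]
      density_eq_distr_particle_path[OF K t r along] nonneg r g P
    by (simp add: mult.commute)
qed

text \<open>In Lagrangian coordinates the kernel only sees the order of the particles, and the paths preserve
  that order; the velocity is therefore the one at time \<open>0\<close>.\<close>

lemma velocity_along_paths:
  assumes t: "0 \<le> t" "t < 1"
    and r: "(\<lambda>x. \<rho> x t) \<in> borel_measurable borel"
    and along: "\<And>a. \<rho> (particle_path K a t) t = indicat_real K a / (1 - t * indicat_real K a)"
  shows "velocity \<rho> (particle_path K a t) t = measure lborel K / 2 - mass_below K a"
proof -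
  interpret finite_measure "patch K" by (rule patch_finite_measure)
  have "velocity \<rho> (particle_path K a t) t
      = - (\<integral>b. newton_potential_x (particle_path K a t - particle_path K b t) \<partial>patch K)"
    unfolding velocity_def
    by (subst integral_along_paths[OF t r along]) (auto simp: newton_potential_x_def[abs_def] sgn_real_def)
  also have "(\<integral>b. newton_potential_x (particle_path K a t - particle_path K b t) \<partial>patch K)
      = (\<integral>b. indicat_real {..a} b - 1/2 \<partial>patch K)"
  proof (rule integral_cong_AE)
    have "AE b in lborel. b \<noteq> a" by (rule AE_lborel_singleton)
    then have "AE b in patch K. b \<noteq> a"
      using patch_set_borel[OF K] by (subst AE_density) auto
    then show "AE b in patch K. newton_potential_x (particle_path K a t - particle_path K b t)
        = indicat_real {..a} b - 1/2"
    proof eventually_elim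
      case (elim b)
      then show ?case
        using particle_path_less_iff[OF K t, of a b] particle_path_less_iff[OF K t, of b a]
        by (auto simp: newton_potential_x_def indicator_def sgn_if)
    qed
    show "(\<lambda>b. newton_potential_x (particle_path K a t - particle_path K b t)) \<in> borel_measurable (patch K)"
    proof -
      have [measurable]: "(\<lambda>b. particle_path K b t) \<in> borel_measurable borel"
        using t by (intro particle_path_measurable[OF K]) auto
      show ?thesis unfolding newton_potential_x_def sgn_real_def by simp
    qed
  qed auto
  also have "\<dots> = measure lborel (K \<inter> {..a}) - measure lborel K / 2"
    using measure_patch[of "{..a}"] measure_patch[of UNIV]
    by (subst Bochner_Integration.integral_diff) (auto simp: emeasure_eq_measure)
  finally show ?thesis by (simp add: mass_below_def)
qed

end

text \<open>Differentiation under the integral sign. The bound on the derivative of \<open>\<phi>\<close> dominates the difference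
  quotients.\<close>

lemma has_real_derivative_integral_along_lines:
  fixes \<phi> w :: "real \<Rightarrow> real"
  assumes "finite_measure N" and N: "sets N = sets borel"
    and diff: "\<phi> differentiable_on UNIV" and cont: "continuous_on UNIV (deriv \<phi>)"
    and bound: "\<And>x. \<bar>deriv \<phi> x\<bar> \<le> B"
    and w: "w \<in> borel_measurable borel" "\<And>a. \<bar>w a\<bar> \<le> m"
    and int: "\<And>s. s \<in> S \<Longrightarrow> integrable N (\<lambda>a. \<phi> (a + s * w a))" and t: "t \<in> S"
  shows "((\<lambda>s. \<integral>a. \<phi> (a + s * w a) \<partial>N) has_real_derivative
    (\<integral>a. deriv \<phi> (a + t * w a) * w a \<partial>N)) (at t within S)"
proof -
  interpret finite_measure N by fact
  have D: "(\<phi> has_real_derivative deriv \<phi> x) (at x)" for x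
    using diff DERIV_deriv_iff_real_differentiable[of \<phi> x] by (simp add: differentiable_on_def)
  have lip: "\<bar>\<phi> x - \<phi> y\<bar> \<le> B * \<bar>x - y\<bar>" for x y
    using field_differentiable_bound[of UNIV \<phi> "deriv \<phi>" B x y] D bound by auto
  have "0 \<le> B" using bound[of 0] by linarith
  have [measurable]: "\<phi> \<in> borel_measurable borel" "deriv \<phi> \<in> borel_measurable borel" "w \<in> borel_measurable borel"
    using borel_measurable_continuous_onI[OF differentiable_imp_continuous_on[OF diff]]
      borel_measurable_continuous_onI[OF cont] w by auto
  have meas: "f \<in> borel_measurable N" if "f \<in> borel_measurable borel" for f :: "real \<Rightarrow> real"
    using that measurable_cong_sets[OF N refl] by blast
  show ?thesis
    unfolding has_field_derivative_iff tendsto_at_iff_sequentially comp_def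
  proof (intro allI impI)
    fix X :: "nat \<Rightarrow> real"
    assume XS: "\<forall>i. X i \<in> S - {t}" and X: "X \<longlonglongrightarrow> t"
    let ?q = "\<lambda>i a. (\<phi> (a + X i * w a) - \<phi> (a + t * w a)) / (X i - t)"
    have "(\<lambda>i. \<integral>a. ?q i a \<partial>N) \<longlonglongrightarrow> (\<integral>a. deriv \<phi> (a + t * w a) * w a \<partial>N)"
    proof (rule integral_dominated_convergence[where w = "\<lambda>_. B * m"])
      show "AE a in N. norm (?q i a) \<le> B * m" for i
      proof (rule AE_I2)
        fix a
        have "\<bar>\<phi> (a + X i * w a) - \<phi> (a + t * w a)\<bar> \<le> B * \<bar>(X i - t) * w a\<bar>"
          using lip[of "a + X i * w a" "a + t * w a"] by (simp add: algebra_simps)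
        also have "\<dots> \<le> B * (\<bar>X i - t\<bar> * m)"
          unfolding abs_mult using w \<open>0 \<le> B\<close> by (intro mult_left_mono) auto
        finally show "norm (?q i a) \<le> B * m"
          using XS by (simp add: divide_simps ac_simps)
      qed
      show "AE a in N. (\<lambda>i. ?q i a) \<longlonglongrightarrow> deriv \<phi> (a + t * w a) * w a"
      proof (rule AE_I2)
        fix a
        have "((\<lambda>s. \<phi> (a + s * w a)) has_real_derivative deriv \<phi> (a + t * w a) * w a) (at t within S)"
          by (rule DERIV_chain'[OF _ D]) (auto intro!: derivative_eq_intros)
        then show "(\<lambda>i. ?q i a) \<longlonglongrightarrow> deriv \<phi> (a + t * w a) * w a"
          using XS X by (auto simp: has_field_derivative_iff tendsto_at_iff_sequentially comp_def)
      qed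
    qed (auto intro!: meas)
    moreover have "(\<integral>a. ?q i a \<partial>N) = ((\<integral>a. \<phi> (a + X i * w a) \<partial>N) - (\<integral>a. \<phi> (a + t * w a) \<partial>N)) / (X i - t)" for i
      using XS t int by (subst integral_divide_zero) (simp add: Bochner_Integration.integral_diff)
    ultimately show "(\<lambda>i. ((\<integral>a. \<phi> (a + X i * w a) \<partial>N) - (\<integral>a. \<phi> (a + t * w a) \<partial>N)) / (X i - t))
        \<longlonglongrightarrow> (\<integral>a. deriv \<phi> (a + t * w a) * w a \<partial>N)" by (simp only:)
  qed
qed

lemma bounded_deriv_compact_support:
  fixes \<phi> :: "real \<Rightarrow> real"
  assumes "continuous_on UNIV (deriv \<phi>)" "compact (closure {x. \<phi> x \<noteq> 0})"
  obtains B where "\<And>x. \<bar>deriv \<phi> x\<bar> \<le> B"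
proof -
  let ?C = "closure {x. \<phi> x \<noteq> 0}"
  have "compact (deriv \<phi> ` ?C)"
    using assms continuous_on_subset by (blast intro: compact_continuous_image)
  then obtain B where B: "\<And>x. x \<in> ?C \<Longrightarrow> \<bar>deriv \<phi> x\<bar> \<le> B" "0 < B"
    using compact_imp_bounded bounded_pos by (metis imageI real_norm_def)
  have "deriv \<phi> x = 0" if "x \<notin> ?C" for x
  proof -
    have "(\<phi> has_real_derivative 0) (at x)"
    proof (rule has_field_derivative_transform_within_open)
      show "((\<lambda>_. 0) has_real_derivative 0) (at x)" by simp
      show "open (- ?C)" by (intro open_Compl closed_closure)
      show "0 = \<phi> y" if "y \<in> - ?C" for y
        using that closure_subset[of "{x. \<phi> x \<noteq> 0}"] by auto
    qed (use that in auto)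
    then show ?thesis by (rule DERIV_imp_deriv)
  qed
  then show ?thesis using B by (intro that[of B]) (metis abs_zero less_imp_le)
qed

definition patch_solution :: "real set \<Rightarrow> real \<Rightarrow> real \<Rightarrow> real" where
  "patch_solution K x t = indicat_real ((\<lambda>a. particle_path K a t) ` K) x / (1 - t)"

text \<open>All clauses reduce to integrals over the initial patch. There the weak equation is the derivative of
  \<open>\<integral> \<phi>(X(a,s)) da\<close> in \<open>s\<close>, and the paths are straight lines.\<close>

lemma aggregation_solution_patch_solution:
  assumes K: "compact K"
  shows "aggregation_solution 1 (indicat_real K) (patch_solution K)"
proof -
  let ?\<rho> = "patch_solution K" and ?w = "\<lambda>a. measure lborel K / 2 - mass_below K a"
  interpret finite_measure "patch K" by (rule patch_finite_measure[OF K])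
  have along: "?\<rho> (particle_path K a t) t = indicat_real K a / (1 - t * indicat_real K a)"
    if "t \<in> {0..<1}" for a t
    using that particle_path_inj[OF K, of t]
    by (auto simp: patch_solution_def indicator_def dest: injD)
  have meas: "(\<lambda>x. ?\<rho> x t) \<in> borel_measurable borel" if "t \<in> {0..<1}" for t
  proof -
    have "compact ((\<lambda>a. particle_path K a t) ` K)"
      using that by (intro compact_continuous_image continuous_on_particle_path K) auto
    then show ?thesis
      unfolding patch_solution_def by (intro borel_measurable_divide borel_measurable_indicator)
        (auto simp: borel_compact)
  qed
  have int: "(\<integral>x. g x * ?\<rho> x t \<partial>lborel) = (\<integral>a. g (particle_path K a t) \<partial>patch K)"
    if "t \<in> {0..<1}" "g \<in> borel_measurable borel" for g t
    using that by (intro integral_along_paths[OF K _ _ meas along]) auto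
  have vel: "velocity ?\<rho> (particle_path K a t) t = ?w a" if "t \<in> {0..<1}" for a t
    using that by (intro velocity_along_paths[OF K _ _ meas along]) auto
  have w_meas: "?w \<in> borel_measurable borel"
    by (intro borel_measurable_diff borel_measurable_const borel_measurable_mono monoI mass_below_mono[OF K])
  have w_bound: "\<bar>?w a\<bar> \<le> measure lborel K" for a
    using mass_below_nonneg[OF K, of a] mass_below_le[OF K, of a] by linarith
  have "weak_continuity_equation 1 ?\<rho> (velocity ?\<rho>)"
    unfolding weak_continuity_equation_def
  proof (intro allI impI ballI)
    fix \<phi> :: "real \<Rightarrow> real" and t :: real
    assume \<phi>: "\<phi> differentiable_on UNIV" "continuous_on UNIV (deriv \<phi>)"
      "compact (closure {x. \<phi> x \<noteq> 0})" and t: "t \<in> {0..<1}"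
    obtain B where B: "\<And>x. \<bar>deriv \<phi> x\<bar> \<le> B"
      using bounded_deriv_compact_support \<phi> by blast
    have c\<phi>: "continuous_on UNIV \<phi>" using \<phi>(1) by (rule differentiable_imp_continuous_on)
    have m\<phi> [measurable]: "\<phi> \<in> borel_measurable borel" "deriv \<phi> \<in> borel_measurable borel"
      using borel_measurable_continuous_onI c\<phi> \<phi>(2) by auto
    have "compact (\<phi> ` closure {x. \<phi> x \<noteq> 0})"
      using \<phi>(3) c\<phi> continuous_on_subset by (blast intro: compact_continuous_image)
    then obtain C where C: "\<And>x. x \<in> closure {x. \<phi> x \<noteq> 0} \<Longrightarrow> \<bar>\<phi> x\<bar> \<le> C" "0 < C"
      using compact_imp_bounded bounded_pos by (metis imageI real_norm_def)
    have \<phi>_bound: "\<bar>\<phi> x\<bar> \<le> C" for x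
      using C closure_subset[of "{x. \<phi> x \<noteq> 0}"] by (cases "\<phi> x = 0") auto
    have "((\<lambda>s. \<integral>a. \<phi> (a + s * ?w a) \<partial>patch K) has_real_derivative
        (\<integral>a. deriv \<phi> (a + t * ?w a) * ?w a \<partial>patch K)) (at t within {0..<1})"
      by (rule has_real_derivative_integral_along_lines[OF patch_finite_measure[OF K] _ \<phi>(1,2) B w_meas w_bound])
        (use w_meas \<phi>_bound t in \<open>auto intro!: integrable_patch[OF K]\<close>)
    moreover have "(\<integral>x. \<phi> x * ?\<rho> x s \<partial>lborel) = (\<integral>a. \<phi> (a + s * ?w a) \<partial>patch K)" if "s \<in> {0..<1}" for s
      using int[OF that m\<phi>(1)] by (simp add: particle_path_def)
    moreover have "(\<integral>x. deriv \<phi> x * (?\<rho> x t * velocity ?\<rho> x t) \<partial>lborel)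
        = (\<integral>a. deriv \<phi> (a + t * ?w a) * ?w a \<partial>patch K)"
    proof -
      obtain Y where Y: "\<And>a. Y (particle_path K a t) = a" "\<And>x. particle_path K (Y x) t = x" "continuous_on UNIV Y"
        using particle_path_homeomorphism[OF K, of t] t unfolding homeomorphism_def by auto
      have [measurable]: "Y \<in> borel_measurable borel" using Y(3) by (rule borel_measurable_continuous_onI)
      have v: "velocity ?\<rho> x t = ?w (Y x)" for x using vel[OF t, of "Y x"] Y by simp
      have "(\<integral>x. (deriv \<phi> x * ?w (Y x)) * ?\<rho> x t \<partial>lborel)
          = (\<integral>a. deriv \<phi> (particle_path K a t) * ?w (Y (particle_path K a t)) \<partial>patch K)"
        by (intro int[OF t] borel_measurable_times m\<phi>
            measurable_compose[OF \<open>Y \<in> borel_measurable borel\<close> w_meas])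
      then show ?thesis unfolding Y(1) by (simp add: v mult_ac particle_path_def)
    qed
    ultimately show "((\<lambda>s. \<integral>x. \<phi> x * ?\<rho> x s \<partial>lborel) has_real_derivative
        (\<integral>x. deriv \<phi> x * (?\<rho> x t * velocity ?\<rho> x t) \<partial>lborel)) (at t within {0..<1})"
      using t by (auto intro: has_field_derivative_transform_within[where d = 1])
  qed
  moreover have "flow_map 1 (velocity ?\<rho>) (particle_path K)"
    unfolding flow_map_def
  proof (intro allI conjI ballI)
    fix a t :: real assume "t \<in> {0..<1}"
    then show "(particle_path K a has_real_derivative velocity ?\<rho> (particle_path K a t) t) (at t within {0..<1})"
      unfolding vel[OF \<open>t \<in> {0..<1}\<close>] unfolding particle_path_def[abs_def]
      by (auto intro!: derivative_eq_intros)
  qed (simp add: particle_path_def)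
  moreover have "integrable lborel (\<lambda>x. ?\<rho> x t)" if "t \<in> {0..<1}" for t
    using integrable_along_paths[OF K _ _ meas[OF that] along[OF that], of "\<lambda>_. 1"] that by auto
  moreover have "?\<rho> x 0 = indicat_real K x" for x
    by (simp add: patch_solution_def particle_path_def)
  ultimately show ?thesis
    unfolding aggregation_solution_def using along particle_path_homeomorphism[OF K]
    by (auto intro!: exI[of _ "particle_path K"])
qed

section \<open>Uniqueness of the flow\<close>

lemma open_connected_bounded_real_eq_Ioo:
  fixes C :: "real set"
  assumes "open C" "connected C" "bounded C" "C \<noteq> {}"
  obtains p q where "p < q" "C = {p<..<q}"
proof -
  have bdd: "bdd_below C" "bdd_above C"
    using bounded_imp_bdd_below[OF assms(3)] bounded_imp_bdd_above[OF assms(3)] .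
  have "Inf C < x \<and> x < Sup C" if x: "x \<in> C" for x
  proof -
    obtain e where e: "0 < e" "cball x e \<subseteq> C"
      using open_contains_cball_eq[OF assms(1)] x by metis
    then have "x - e \<in> C" "x + e \<in> C" by (auto simp: dist_real_def)
    then show ?thesis using cInf_lower[of "x - e" C, OF _ bdd(1)] cSup_upper[of "x + e" C, OF _ bdd(2)] e(1) by linarith
  qed
  moreover have "x \<in> C" if x: "Inf C < x" "x < Sup C" for x
  proof -
    obtain y z where "y \<in> C" "y < x" "z \<in> C" "x < z"
      using x cInf_less_iff[OF assms(4) bdd(1), of x] less_cSup_iff[OF assms(4) bdd(2), of x] by blast
    then show ?thesis using connected_contains_Icc[OF assms(2), of y z] by auto
  qed
  ultimately have "C = {Inf C<..<Sup C}" by auto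
  then show ?thesis using assms(4) that[of "Inf C" "Sup C"] by (cases "Inf C < Sup C") auto
qed

text \<open>An open subset of the line is the disjoint union of its components, which are countably many
  open intervals. The lemma is used for the complement of the patch, on which lengths are known to
  be preserved only interval by interval.\<close>

lemma emeasure_open_eqI_Ioo:
  fixes M N :: "real measure"
  assumes "sets M = sets borel" "sets N = sets borel" "open U" "bounded U"
    and "\<And>p q. p < q \<Longrightarrow> {p<..<q} \<subseteq> U \<Longrightarrow> emeasure M {p<..<q} = emeasure N {p<..<q}"
  shows "emeasure M U = emeasure N U"
proof -
  have op: "open C" if "C \<in> components U" for C
    using open_components[OF assms(3) that] .
  have cnt: "countable (components U)"
    using pairwise_disjoint_components[of U]
    by (intro countable_disjoint_open_subsets op) (auto simp: pairwise_def disjnt_def)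
  have disj: "disjoint_family_on (\<lambda>C. C) (components U)"
    using pairwise_disjoint_components[of U] by (auto simp: disjoint_family_on_def pairwise_def)
  have "emeasure L U = (\<integral>\<^sup>+ C. emeasure L C \<partial>count_space (components U))"
    if "sets L = sets borel" for L
    using emeasure_UN_countable[of "components U" "\<lambda>C. C" L, OF _ cnt disj] op that by simp
  moreover have "emeasure M C = emeasure N C" if C: "C \<in> components U" for C
  proof -
    have "C \<subseteq> U" "C \<noteq> {}" "connected C"
      using in_components_subset[OF that] in_components_nonempty[OF that] in_components_connected[OF that] .
    then obtain p q where "p < q" "C = {p<..<q}"
      using open_connected_bounded_real_eq_Ioo[of C] op[OF C] bounded_subset[OF assms(4)] by metis
    then show ?thesis using assms(5)[of p q] \<open>C \<subseteq> U\<close> by simp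
  qed
  ultimately show ?thesis
    using assms(1,2) nn_integral_cong[of "count_space (components U)" "emeasure M" "emeasure N"] by simp
qed

text \<open>The kernels centred at \<open>x\<close> and \<open>y\<close> cancel outside \<open>[x,y]\<close> and differ by the constant \<open>1\<close> inside.\<close>

lemma velocity_diff:
  assumes int: "integrable lborel (\<lambda>y. \<rho> y t)" and "x \<le> y"
  shows "velocity \<rho> y t - velocity \<rho> x t = - (\<integral>u. indicat_real {x<..<y} u * \<rho> u t \<partial>lborel)"
proof -
  have i: "integrable lborel (\<lambda>u. newton_potential_x (z - u) * \<rho> u t)" for z
  proof (rule Bochner_Integration.integrable_bound[OF int])
    show "(\<lambda>u. newton_potential_x (z - u) * \<rho> u t) \<in> borel_measurable lborel"
      using int unfolding newton_potential_x_def sgn_real_def by measurable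
    show "AE u in lborel. norm (newton_potential_x (z - u) * \<rho> u t) \<le> norm (\<rho> u t)"
      by (auto simp: newton_potential_x_def abs_mult sgn_if)
  qed
  have "velocity \<rho> y t - velocity \<rho> x t
    = - (\<integral>u. newton_potential_x (y - u) * \<rho> u t - newton_potential_x (x - u) * \<rho> u t \<partial>lborel)"
    unfolding velocity_def using i by simp
  also have "(\<integral>u. newton_potential_x (y - u) * \<rho> u t - newton_potential_x (x - u) * \<rho> u t \<partial>lborel)
    = (\<integral>u. indicat_real {x<..<y} u * \<rho> u t \<partial>lborel)"
  proof (rule integral_cong_AE)
    show "AE u in lborel. newton_potential_x (y - u) * \<rho> u t - newton_potential_x (x - u) * \<rho> u t
        = indicat_real {x<..<y} u * \<rho> u t"
      using AE_lborel_singleton[of x] AE_lborel_singleton[of y]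
      by eventually_elim (use \<open>x \<le> y\<close> in \<open>auto simp: newton_potential_x_def indicator_def sgn_if\<close>)
  qed (use i int in auto)
  finally show ?thesis .
qed

context
  fixes K :: "real set" and \<rho> X :: "real \<Rightarrow> real \<Rightarrow> real"
  assumes K: "compact K"
    and int: "\<And>t. t \<in> {0..<1} \<Longrightarrow> integrable lborel (\<lambda>x. \<rho> x t)"
    and flow: "flow_map 1 (velocity \<rho>) X"
    and homeo: "\<And>t. t \<in> {0..<1} \<Longrightarrow> \<exists>Y. homeomorphism UNIV UNIV (\<lambda>a. X a t) Y"
    and along: "\<And>a t. t \<in> {0..<1} \<Longrightarrow> \<rho> (X a t) t = indicat_real K a / (1 - t * indicat_real K a)"
begin

lemma flow_at_0: "X a 0 = a"
  using flow by (simp add: flow_map_def)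

lemma flow_has_derivative:
  "t \<in> {0..<1} \<Longrightarrow> (X a has_real_derivative velocity \<rho> (X a t) t) (at t within {0..<1})"
  using flow by (simp add: flow_map_def)

lemma flow_eq_iff: "t \<in> {0..<1} \<Longrightarrow> X a t = X b t \<longleftrightarrow> a = b"
  using homeo unfolding homeomorphism_def by (metis UNIV_I)

text \<open>The difference of two particles is continuous in time and never zero because the flow is injective, so it
  keeps its sign.\<close>

lemma flow_less_iff:
  assumes t: "t \<in> {0..<1}"
  shows "X a t < X b t \<longleftrightarrow> a < b"
proof -
  have "X a t < X b t" if "a < b" for a b
  proof (rule ccontr)
    assume "\<not> X a t < X b t"
    then have "X b t - X a t \<le> 0" by simp
    moreover have "0 \<le> X b 0 - X a 0" using that by (simp add: flow_at_0)
    moreover have "continuous_on {0..t} (\<lambda>s. X b s - X a s)"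
      using t flow_has_derivative
      by (intro continuous_on_diff continuous_on_subset[OF DERIV_continuous_on[of "{0..<1}"]]) auto
    ultimately obtain s where "0 \<le> s" "s \<le> t" "X b s - X a s = 0"
      using IVT2'[of "\<lambda>s. X b s - X a s" t 0 0] t by auto
    then show False using flow_eq_iff[of s b a] t that by auto
  qed
  then show ?thesis using flow_eq_iff[OF t] by (metis linorder_neq_iff order_less_asym)
qed

lemma flow_image_Ioo:
  assumes t: "t \<in> {0..<1}"
  shows "(\<lambda>a. X a t) ` {p<..<q} = {X p t<..<X q t}"
proof -
  have "y \<in> (\<lambda>a. X a t) ` {p<..<q}" if "X p t < y" "y < X q t" for y
  proof -
    obtain a where "y = X a t" using homeo[OF t] unfolding homeomorphism_def by (metis UNIV_I)
    then show ?thesis using that flow_less_iff[OF t] by auto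
  qed
  then show ?thesis using flow_less_iff[OF t] by auto
qed

text \<open>Images under the flow map are preimages under its inverse; the length of an image is thus a measure in
  its argument, namely the distribution of the inverse.\<close>

lemma flow_image_eq_vimage:
  assumes t: "t \<in> {0..<1}"
  obtains Y where "Y \<in> borel_measurable borel" "\<And>B. (\<lambda>a. X a t) ` B = Y -` B"
proof -
  obtain Y where Y: "\<And>a. Y (X a t) = a" "\<And>y. X (Y y) t = y" "continuous_on UNIV Y"
    using homeo[OF t] unfolding homeomorphism_def by auto
  have im: "(\<lambda>a. X a t) ` B = Y -` B" for B using Y by (auto simp: image_iff) metis
  have m: "Y \<in> borel_measurable borel" using Y(3) by (rule borel_measurable_continuous_onI)
  show thesis using that[OF m im] .
qed

lemma flow_image_borel:
  assumes t: "t \<in> {0..<1}" and "A \<in> sets borel"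
  shows "(\<lambda>a. X a t) ` A \<in> sets borel"
  using flow_image_eq_vimage[OF t] measurable_sets_borel[OF _ assms(2)] by metis

lemma density_eq_indicator_image:
  assumes t: "t \<in> {0..<1}"
  shows "\<rho> y t = indicat_real ((\<lambda>a. X a t) ` K) y / (1 - t)"
proof -
  obtain a where "y = X a t" using homeo[OF t] unfolding homeomorphism_def by (metis UNIV_I)
  then show ?thesis using along[OF t, of a] flow_eq_iff[OF t] by (auto simp: indicator_def)
qed

lemma velocity_diff_flow:
  assumes t: "t \<in> {0..<1}" and "a \<le> b"
  shows "velocity \<rho> (X b t) t - velocity \<rho> (X a t) t
    = - measure lborel ((\<lambda>a. X a t) ` (K \<inter> {a<..<b})) / (1 - t)"
proof -
  have "X a t \<le> X b t" using assms flow_less_iff[OF t] by (meson linorder_not_less)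
  have inj: "inj (\<lambda>a. X a t)" using flow_eq_iff[OF t] by (auto intro: injI)
  have "(\<integral>u. indicat_real {X a t<..<X b t} u * \<rho> u t \<partial>lborel)
      = (\<integral>u. indicat_real ((\<lambda>a. X a t) ` (K \<inter> {a<..<b})) u / (1 - t) \<partial>lborel)"
    unfolding image_Int[OF inj] flow_image_Ioo[OF t] density_eq_indicator_image[OF t]
    by (intro Bochner_Integration.integral_cong) (auto simp: indicator_def)
  also have "\<dots> = measure lborel ((\<lambda>a. X a t) ` (K \<inter> {a<..<b})) / (1 - t)" by simp
  finally show ?thesis
    using velocity_diff[of \<rho> t, OF int[OF t] \<open>X a t \<le> X b t\<close>] by simp
qed

lemma flow_diff_has_derivative:
  assumes t: "t \<in> {0..<1}" and "a \<le> b"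
  shows "((\<lambda>t. X b t - X a t) has_real_derivative
    - measure lborel ((\<lambda>a. X a t) ` (K \<inter> {a<..<b})) / (1 - t)) (at t within {0..<1})"
  unfolding velocity_diff_flow[OF assms, symmetric]
  by (rule DERIV_diff[OF flow_has_derivative[OF t] flow_has_derivative[OF t]])

text \<open>No mass lies between the images of the end points of a gap, so these points move with equal
  velocity.\<close>

lemma flow_diff_gap:
  assumes t: "t \<in> {0..<1}" and "a \<le> b" and gap: "K \<inter> {a<..<b} = {}"
  shows "X b t - X a t = b - a"
proof -
  have "\<exists>c. \<forall>t\<in>{0..<1}. X b t - X a t = c"
    using flow_diff_has_derivative[OF _ \<open>a \<le> b\<close>]
    by (intro has_field_derivative_zero_constant) (auto simp: gap)
  then show ?thesis using t by (metis atLeastLessThan_iff flow_at_0 order_refl zero_less_one)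
qed

lemma flow_preserves_measure_gaps:
  assumes t: "t \<in> {0..<1}"
  shows "measure lborel ((\<lambda>a. X a t) ` ({a<..<b} - K)) = measure lborel ({a<..<b} - K)"
proof -
  obtain Y where Y: "Y \<in> borel_measurable borel" "\<And>B. (\<lambda>a. X a t) ` B = Y -` B"
    using flow_image_eq_vimage[OF t] by blast
  have em: "emeasure (distr lborel borel Y) A = emeasure lborel ((\<lambda>a. X a t) ` A)" if "A \<in> sets borel" for A
    using that Y by (simp add: emeasure_distr)
  have op: "open ({a<..<b} - K)"
    using K by (intro open_Diff) (auto intro: compact_imp_closed)
  have "emeasure (distr lborel borel Y) ({a<..<b} - K) = emeasure lborel ({a<..<b} - K)"
  proof (rule emeasure_open_eqI_Ioo)
    fix p q :: real assume pq: "p < q" "{p<..<q} \<subseteq> {a<..<b} - K"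
    then have "X q t - X p t = q - p" using flow_diff_gap[OF t, of p q] by auto
    then show "emeasure (distr lborel borel Y) {p<..<q} = emeasure lborel {p<..<q}"
      using pq flow_less_iff[OF t, of p q] by (simp add: em flow_image_Ioo[OF t])
  qed (use op in \<open>auto intro: bounded_subset[of "{a<..<b}"]\<close>)
  then show ?thesis using op by (simp add: em measure_def)
qed

text \<open>Let \<open>D\<close> be the distance of the two particles and \<open>m\<close> the length of the image of \<open>K\<close> between them.
  Since the complement of \<open>K\<close> keeps its length, \<open>D - m\<close> is constant, while
  \<open>D' = - m / (1 - t)\<close>. Hence \<open>m' = - m / (1 - t)\<close>, that is, \<open>m / (1 - t)\<close> is constant.\<close>

lemma measure_flow_image:
  assumes t: "t \<in> {0..<1}" and "a \<le> b"
  shows "measure lborel ((\<lambda>a. X a t) ` (K \<inter> {a<..<b})) = (1 - t) * measure lborel (K \<inter> {a<..<b})"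
proof -
  let ?U = "{a<..<b} - K" and ?m = "\<lambda>t. measure lborel ((\<lambda>a. X a t) ` (K \<inter> {a<..<b}))"
  have m: "?m t = (X b t - X a t) - measure lborel ?U" if t: "t \<in> {0..<1}" for t
  proof -
    let ?F = "\<lambda>a. X a t"
    have inj: "inj ?F" using flow_eq_iff[OF t] by (auto intro: injI)
    have fm: "?F ` A \<in> fmeasurable lborel" if "A \<in> sets borel" "A \<subseteq> {a<..<b}" for A
    proof (rule fmeasurableI2)
      show "{X a t<..<X b t} \<in> fmeasurable lborel"
        using emeasure_lborel_box_finite[of "X a t" "X b t"] by (intro fmeasurableI) auto
      show "?F ` A \<subseteq> {X a t<..<X b t}" using that(2) flow_image_Ioo[OF t, of a b] by blast
    qed (use flow_image_borel[OF t that(1)] in auto)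
    have "?F ` (K \<inter> {a<..<b}) \<union> ?F ` ?U = {X a t<..<X b t}"
      unfolding flow_image_Ioo[OF t, symmetric] by blast
    moreover have "?F ` (K \<inter> {a<..<b}) \<inter> ?F ` ?U = {}"
      using inj by (auto dest: injD)
    moreover have "measure lborel (?F ` (K \<inter> {a<..<b}) \<union> ?F ` ?U)
        = ?m t + measure lborel (?F ` ?U)"
      using calculation(2) patch_set_borel[OF K]
      by (intro measure_Un_AE AE_I2 fm) auto
    ultimately show ?thesis
      using flow_preserves_measure_gaps[OF t, of a b] assms(2) flow_less_iff[OF t, of b a] by simp
  qed
  have "\<exists>c. \<forall>t\<in>{0..<1}. ?m t / (1 - t) = c"
  proof (rule has_field_derivative_zero_constant)
    fix t :: real assume t: "t \<in> {0..<1}"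
    have "(?m has_real_derivative - ?m t / (1 - t)) (at t within {0..<1})"
    proof (rule has_field_derivative_transform_within[where d = 1])
      show "((\<lambda>t. (X b t - X a t) - measure lborel ?U) has_real_derivative - ?m t / (1 - t)) (at t within {0..<1})"
        using DERIV_diff[OF flow_diff_has_derivative[OF t assms(2)] DERIV_const] by simp
    qed (use t m in auto)
    then show "((\<lambda>t. ?m t / (1 - t)) has_real_derivative 0) (at t within {0..<1})"
      by (rule DERIV_divide[THEN DERIV_cong]) (use t in \<open>auto intro!: derivative_eq_intros\<close>)
  qed auto
  then have "?m t / (1 - t) = ?m 0 / (1 - 0)"
    using t by (metis atLeastLessThan_iff order_refl zero_less_one)
  then show ?thesis using t by (simp add: flow_at_0 field_simps)
qed

text \<open>The whole mass lies to the right of a particle that starts left of \<open>K\<close>, which fixes the velocity of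
  that particle; the velocity of any other one follows by adding the velocity difference.\<close>

lemma flow_eq_particle_path:
  assumes "t \<in> {0..<1}"
  shows "X c t = particle_path K c t"
proof -
  obtain R where R: "\<And>x. x \<in> K \<Longrightarrow> \<bar>x\<bar> \<le> R"
    using compact_imp_bounded[OF K] by (metis bounded_iff real_norm_def)
  \<comment> \<open>The particle \<open>a\<close> starts left of \<open>c\<close> and of the patch, and \<open>b\<close> right of both.\<close>
  define a where "a = min c (- R) - 1"
  define b where "b = max c R + 1"
  have Kab: "K \<inter> {a<..<b} = K" "K \<inter> {..a} = {}" "a < b" "a < c"
    using R by (fastforce simp: a_def b_def)+
  have vel: "velocity \<rho> (X c t) t = measure lborel K / 2 - mass_below K c" if t: "t \<in> {0..<1}" for t
  proof -
    let ?Kt = "(\<lambda>a. X a t) ` K"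
    have right: "X a t < y" if "y \<in> ?Kt" for y
      using that Kab flow_less_iff[OF t] by force
    have "velocity \<rho> (X a t) t = - (\<integral>y. - (indicat_real ?Kt y / (1 - t)) / 2 \<partial>lborel)"
      unfolding velocity_def density_eq_indicator_image[OF t]
      by (intro arg_cong[where f = uminus] Bochner_Integration.integral_cong)
        (use right in \<open>fastforce simp: indicator_def newton_potential_x_def\<close>)+
    also have "\<dots> = measure lborel ?Kt / (1 - t) / 2"
      by simp
    also have "\<dots> = measure lborel K / 2"
      using measure_flow_image[OF t, of a b] Kab t by simp
    finally have "velocity \<rho> (X a t) t = measure lborel K / 2" .
    moreover have "velocity \<rho> (X c t) t - velocity \<rho> (X a t) t = - measure lborel (K \<inter> {a<..<c})"
      using velocity_diff_flow[OF t, of a c] measure_flow_image[OF t, of a c] Kab t by simp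
    moreover have "measure lborel (K \<inter> {a<..<c}) = mass_below K c"
    proof -
      have "measure lborel (K \<inter> {a<..<c}) = measure lborel (K \<inter> {..c})"
      proof (rule measure_eq_AE)
        show "AE x in lborel. x \<in> K \<inter> {a<..<c} \<longleftrightarrow> x \<in> K \<inter> {..c}"
          using AE_lborel_singleton[of c] by eventually_elim (use Kab(2) in force)
      qed (use patch_set_borel[OF K] in auto)
      then show ?thesis by (simp add: mass_below_def)
    qed
    ultimately show ?thesis by simp
  qed
  have "\<exists>k. \<forall>t\<in>{0..<1}. X c t - t * (measure lborel K / 2 - mass_below K c) = k"
  proof (rule has_field_derivative_zero_constant)
    fix t :: real assume t: "t \<in> {0..<1}"
    show "((\<lambda>t. X c t - t * (measure lborel K / 2 - mass_below K c)) has_real_derivative 0) (at t within {0..<1})"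
      using DERIV_diff[OF flow_has_derivative[OF t, of c]
          DERIV_cmult_right[OF DERIV_ident, of "measure lborel K / 2 - mass_below K c"]] vel[OF t] by simp
  qed auto
  then have "X c t - t * (measure lborel K / 2 - mass_below K c) = X c 0"
    using assms by (metis atLeastLessThan_iff order_refl zero_less_one diff_zero mult_zero_left)
  then show ?thesis by (simp add: particle_path_def flow_at_0)
qed

end

section \<open>Weak convergence at the collapse time\<close>

text \<open>Test functions may be unbounded, but the paths that start in \<open>K\<close> stay in a fixed compact interval
  for \<open>0 \<le> t \<le> 1\<close>, on which a continuous function is bounded.\<close>

lemma solution_weak_convergence_at_1:
  assumes K: "compact K" and sol: "aggregation_solution 1 (indicat_real K) \<rho>"
  shows "weak_convergence (\<lambda>t. density lborel (\<lambda>x. ennreal (\<rho> x t)))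
    (distr (patch K) borel (\<lambda>a. particle_path K a 1)) (at_left 1)"
  unfolding weak_convergence_def
proof (intro allI impI conjI)
  let ?P = "particle_path K"
  obtain X where int: "\<And>t. t \<in> {0..<1} \<Longrightarrow> integrable lborel (\<lambda>x. \<rho> x t)"
    and X: "flow_map 1 (velocity \<rho>) X"
      "\<And>t. t \<in> {0..<1} \<Longrightarrow> \<exists>Y. homeomorphism UNIV UNIV (\<lambda>a. X a t) Y"
      "\<And>a t. t \<in> {0..<1} \<Longrightarrow> \<rho> (X a t) t = indicat_real K a / (1 - t * indicat_real K a)"
    using sol unfolding aggregation_solution_def by blast
  have along: "\<rho> (?P a t) t = indicat_real K a / (1 - t * indicat_real K a)" if "t \<in> {0..<1}" for a t
    using X(3)[OF that] flow_eq_particle_path[OF K int X that] by simp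
  have dens: "density lborel (\<lambda>x. ennreal (\<rho> x t)) = distr (patch K) borel (\<lambda>a. ?P a t)"
    if "t \<in> {0..<1}" for t
    using that int[OF that] along[OF that] by (intro density_eq_distr_particle_path[OF K]) auto
  have P: "(\<lambda>a. ?P a t) \<in> borel_measurable borel" if "t \<in> {0..1}" for t
    using that by (intro particle_path_measurable[OF K]) auto
  \<comment> \<open>Solutions are described only for \<open>t \<ge> 0\<close>, so the left-sided limit is restricted to these times.\<close>
  have at_left: "at_left (1::real) = at 1 within {0..<1}"
    by (rule at_within_nhd[where S = "{0<..<2}"]) auto
  fix g :: "real \<Rightarrow> real" assume cont: "continuous_on UNIV g"
  then have g: "g \<in> borel_measurable borel" by (rule borel_measurable_continuous_onI)
  obtain R where R: "\<And>x. x \<in> K \<Longrightarrow> \<bar>x\<bar> \<le> R"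
    using compact_imp_bounded[OF K] by (metis bounded_iff real_norm_def)
  let ?I = "{- (R + measure lborel K)..R + measure lborel K}"
  have "compact (g ` ?I)"
    using cont continuous_on_subset by (intro compact_continuous_image) auto
  then obtain B where B: "\<And>x. x \<in> ?I \<Longrightarrow> \<bar>g x\<bar> \<le> B"
    using compact_imp_bounded by (metis bounded_iff image_eqI real_norm_def)
  have gP: "\<bar>g (?P a t)\<bar> \<le> B" if "t \<in> {0..1}" "a \<in> K" for a t
  proof (rule B)
    show "?P a t \<in> ?I"
      using particle_path_displacement[OF K, of t a] R[OF that(2)] that(1) by auto
  qed
  have int_gP: "integrable (distr (patch K) borel (\<lambda>a. ?P a t)) g" if "t \<in> {0..1}" for t
    using P[OF that] g gP[OF that]
    by (subst integrable_distr_eq) (auto intro!: integrable_patch[OF K])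
  show "\<forall>\<^sub>F t in at_left 1. integrable (density lborel (\<lambda>x. ennreal (\<rho> x t))) g"
    unfolding at_left eventually_at_filter using dens int_gP by (auto intro!: always_eventually)
  show "integrable (distr (patch K) borel (\<lambda>a. ?P a 1)) g"
    by (rule int_gP) simp
  have "((\<lambda>t. \<integral>a. g (?P a t) \<partial>patch K) \<longlongrightarrow> (\<integral>a. g (?P a 1) \<partial>patch K)) (at 1 within {0..<1})"
    unfolding tendsto_at_iff_sequentially comp_def
  proof (intro allI impI)
    fix T :: "nat \<Rightarrow> real" assume T: "\<forall>i. T i \<in> {0..<1} - {1}" "T \<longlonglongrightarrow> 1"
    show "(\<lambda>i. \<integral>a. g (?P a (T i)) \<partial>patch K) \<longlonglongrightarrow> (\<integral>a. g (?P a 1) \<partial>patch K)"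
    proof (rule integral_dominated_convergence[where w = "\<lambda>_. B"])
      show "(\<lambda>a. g (?P a 1)) \<in> borel_measurable (patch K)"
        "\<And>i. (\<lambda>a. g (?P a (T i))) \<in> borel_measurable (patch K)"
        using T by (auto intro!: measurable_compose[OF P g] simp: less_imp_le)
      show "integrable (patch K) (\<lambda>_. B)" by (rule integrable_patch[OF K, of _ "\<bar>B\<bar>"]) auto
      show "AE a in patch K. (\<lambda>i. g (?P a (T i))) \<longlonglongrightarrow> g (?P a 1)"
      proof (intro AE_I2 isCont_tendsto_compose[of _ g])
        fix a show "(\<lambda>i. ?P a (T i)) \<longlonglongrightarrow> ?P a 1"
          unfolding particle_path_def by (intro tendsto_intros T)
      qed (use cont continuous_on_eq_continuous_at[OF open_UNIV] in blast)
      show "AE a in patch K. norm (g (?P a (T i))) \<le> B" for i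
        using AE_patch[OF K] by eventually_elim (use gP T in \<open>auto simp: less_imp_le\<close>)
    qed
  qed
  then show "((\<lambda>t. \<integral>x. g x \<partial>density lborel (\<lambda>x. ennreal (\<rho> x t)))
      \<longlongrightarrow> (\<integral>x. g x \<partial>distr (patch K) borel (\<lambda>a. ?P a 1))) (at_left 1)"
    unfolding at_left
    by (rule Lim_transform_within[where d = 1, THEN tendsto_eq_rhs])
      (use P g in \<open>auto simp: dens integral_distr\<close>)
qed

section \<open>A patch that collapses to a given measure\<close>

text \<open>The complement of the support is a union of open null sets, and by second countability a
  countable subfamily has the same union.\<close>

lemma emeasure_Compl_measure_support:
  fixes M :: "'a::second_countable_topology measure"
  assumes sets: "sets M = sets borel"
  shows "emeasure M (- measure_support M) = 0"
proof -
  let ?F = "{U. open U \<and> emeasure M U = 0}"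
  have "- measure_support M = \<Union>?F"
    by (auto simp: measure_support_def zero_less_iff_neq_zero)
  moreover obtain F' where "F' \<subseteq> ?F" "countable F'" "\<Union>F' = \<Union>?F"
    using Lindelof[of ?F] by blast
  moreover have "\<Union>F' \<in> null_sets M"
    using calculation sets null_sets_UN'[of F' "\<lambda>U. U" M] by (auto simp: null_sets_def subset_iff)
  ultimately show ?thesis by auto
qed

context finite_borel_measure
begin

text \<open>The initial position of the particle that arrives at \<open>x\<close> at time \<open>1\<close>. If \<open>x\<close> is an atom of mass
  \<open>m\<close>, then an interval of length \<open>m\<close> arrives there, and its right end point is taken.\<close>

definition spread :: "real \<Rightarrow> real" where
  "spread x = x - measure M (space M) / 2 + cdf M x"

definition collapse :: "real \<Rightarrow> real" where
  "collapse a = Inf {x. a \<le> spread x}"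

lemma spread_diff_ge: "x \<le> y \<Longrightarrow> y - x \<le> spread y - spread x"
  using cdf_nondecreasing[of x y] by (simp add: spread_def)

lemma spread_bounds:
  "x - measure M (space M) / 2 \<le> spread x" "spread x \<le> x + measure M (space M) / 2"
  using cdf_nonneg[of x] cdf_bounded[of x] by (simp_all add: spread_def)

text \<open>Right continuity of the distribution function makes the infimum in the definition of \<open>collapse\<close> a
  minimum. The resulting Galois connection is all that is needed about \<open>collapse\<close>.\<close>

lemma collapse_le_iff: "collapse a \<le> x \<longleftrightarrow> a \<le> spread x"
proof -
  let ?S = "{x. a \<le> spread x}" and ?m = "measure M (space M)"
  have "a + ?m / 2 \<in> ?S" using spread_bounds(1)[of "a + ?m / 2"] by simp
  then have ne: "?S \<noteq> {}" by blast
  have bdd: "bdd_below ?S"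
  proof (rule bdd_belowI)
    fix x assume "x \<in> ?S"
    then show "a - ?m / 2 \<le> x" using spread_bounds(2)[of x] by simp
  qed
  have "a \<le> spread (Inf ?S)"
  proof (rule tendsto_lowerbound)
    show "(spread \<longlongrightarrow> spread (Inf ?S)) (at_right (Inf ?S))"
      using cdf_is_right_cont[of "Inf ?S"] unfolding spread_def[abs_def] continuous_within
      by (intro tendsto_intros)
    show "\<forall>\<^sub>F y in at_right (Inf ?S). a \<le> spread y"
      unfolding eventually_at_filter
    proof (intro always_eventually allI impI)
      fix y assume "y \<in> {Inf ?S<..}"
      then obtain s where "a \<le> spread s" "s < y" using cInf_less_iff[OF ne bdd, of y] by auto
      then show "a \<le> spread y" using spread_diff_ge[of s y] by linarith
    qed
  qed simp
  then have "a \<le> spread x" if "collapse a \<le> x"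
    using spread_diff_ge[OF that] that by (simp add: collapse_def)
  moreover have "collapse a \<le> x" if "a \<le> spread x"
    using that cInf_lower[OF _ bdd, of x] by (simp add: collapse_def)
  ultimately show ?thesis by blast
qed

lemma collapse_mono: "a \<le> b \<Longrightarrow> collapse a \<le> collapse b"
  by (meson collapse_le_iff order_refl order_trans)

lemma collapse_diff_le: "a \<le> b \<Longrightarrow> collapse b - collapse a \<le> b - a"
proof -
  assume "a \<le> b"
  have "collapse b \<le> collapse a + (b - a)"
    unfolding collapse_le_iff
    using spread_diff_ge[of "collapse a" "collapse a + (b - a)"] \<open>a \<le> b\<close> collapse_le_iff[of a "collapse a"]
    by linarith
  then show ?thesis by simp
qed

lemma collapse_displacement: "\<bar>collapse a - a\<bar> \<le> measure M (space M) / 2"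
  using spread_bounds(1)[of "a + measure M (space M) / 2"] collapse_le_iff[of a "a + measure M (space M) / 2"]
    spread_bounds(2)[of "collapse a"] collapse_le_iff[of a "collapse a"]
  unfolding abs_le_iff by auto

lemma continuous_on_collapse: "continuous_on S collapse"
proof -
  have "\<bar>collapse a - collapse b\<bar> \<le> \<bar>a - b\<bar>" for a b
    using collapse_mono[of a b] collapse_mono[of b a] collapse_diff_le[of a b] collapse_diff_le[of b a]
    by (cases "a \<le> b") auto
  then show ?thesis
    unfolding continuous_on_iff dist_real_def by (meson le_less_trans)
qed

lemma collapse_measurable [measurable]: "collapse \<in> borel_measurable borel"
  using continuous_on_collapse by (rule borel_measurable_continuous_onI)

text \<open>By the Galois connection, the preimage of \<open>(x,y]\<close> is the interval from \<open>spread x\<close> to \<open>spread y\<close>, whose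
  length is \<open>y - x\<close> plus the mass of \<open>(x,y]\<close>.\<close>

lemma emeasure_collapse_vimage:
  assumes "A \<in> sets borel"
  shows "emeasure lborel (collapse -` A) = emeasure lborel A + emeasure M A"
proof -
  \<comment> \<open>The sum of Lebesgue measure and \<open>M\<close>.\<close>
  define N where "N = measure_of UNIV (sets borel) (\<lambda>A. emeasure lborel A + emeasure M A)"
  have sa: "sigma_algebra UNIV (sets (borel :: real measure))"
    using sets.sigma_algebra_axioms[of "borel :: real measure"] by simp
  have sets_N: "sets N = sets borel"
    unfolding N_def using sigma_algebra.sets_measure_of_eq[OF sa] by simp
  have em_N: "emeasure N A = emeasure lborel A + emeasure M A" if "A \<in> sets borel" for A
    unfolding N_def
  proof (rule emeasure_measure_of_sigma[OF sa _ _ that])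
    show "countably_additive (sets borel) (\<lambda>A. emeasure lborel A + emeasure M A)"
      unfolding countably_additive_def
    proof (intro allI impI)
      fix A :: "nat \<Rightarrow> real set"
      assume A: "range A \<subseteq> sets borel" "disjoint_family A"
      then show "(\<Sum>i. emeasure lborel (A i) + emeasure M (A i))
          = emeasure lborel (\<Union>i. A i) + emeasure M (\<Union>i. A i)"
        using suminf_emeasure[of A lborel] suminf_emeasure[of A M] M_is_borel
        by (simp add: suminf_add[symmetric])
    qed
  qed (simp add: positive_def)
  have "distr lborel borel collapse = N"
  proof (rule borel_measure_eqI_Ioc)
    have Ioc: "emeasure (distr lborel borel collapse) {x<..y} = ennreal (spread y - spread x)"
      if "x \<le> y" for x y
    proof -
      have "collapse -` {x<..y} = {spread x<..spread y}"
        using collapse_le_iff by (auto simp: not_le[symmetric])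
      then show ?thesis using spread_diff_ge[OF that] that by (simp add: emeasure_distr)
    qed
    then show "emeasure (distr lborel borel collapse) {x<..y} \<noteq> \<infinity>" for x y
      by (cases "x \<le> y") auto
    show "emeasure (distr lborel borel collapse) {x<..y} = emeasure N {x<..y}" if "x \<le> y" for x y
    proof -
      have "emeasure M {x<..y} = ennreal (cdf M y - cdf M x)"
        using cdf_diff_eq[of x y] that by (cases "x = y") (auto simp: emeasure_eq_measure)
      then show ?thesis using that Ioc[OF that] cdf_nondecreasing[OF that]
        by (simp add: em_N spread_def algebra_simps flip: ennreal_plus)
    qed
  qed (use sets_N in auto)
  then show ?thesis using em_N[OF assms] assms emeasure_distr[of collapse lborel borel A] by simp
qed

context
  fixes S :: "real set"
  assumes S: "compact S" and null: "emeasure lborel S = 0" and conc: "emeasure M (- S) = 0"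
begin

lemma emeasure_inter_concentration:
  assumes "A \<in> sets borel" shows "emeasure M (S \<inter> A) = emeasure M A"
proof (rule emeasure_eq_AE)
  have "- S \<in> null_sets M" using S conc by (intro null_setsI sets_M borel_comp) (auto simp: borel_compact)
  then have "AE x in M. x \<notin> - S" by (rule AE_not_in)
  then show "AE x in M. x \<in> S \<inter> A \<longleftrightarrow> x \<in> A" by eventually_elim auto
qed (use S assms in \<open>auto simp: M_is_borel borel_compact\<close>)

text \<open>On \<open>S\<close> the Lebesgue part of the image measure vanishes and the other part is all of \<open>M\<close>.\<close>

lemma emeasure_collapse_vimage_inter:
  assumes "A \<in> sets borel"
  shows "emeasure lborel (collapse -` S \<inter> collapse -` A) = emeasure M A"
proof -
  have "S \<inter> A \<in> sets borel" using S assms by (auto simp: borel_compact)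
  moreover have "emeasure lborel (S \<inter> A) = 0"
    using null emeasure_mono[of "S \<inter> A" S lborel] S by (simp add: borel_compact)
  ultimately show ?thesis
    using emeasure_collapse_vimage[of "S \<inter> A"] emeasure_inter_concentration[OF assms] by simp
qed

lemma compact_collapse_vimage: "compact (collapse -` S)"
proof -
  obtain R where R: "\<And>x. x \<in> S \<Longrightarrow> \<bar>x\<bar> \<le> R"
    using compact_imp_bounded[OF S] by (metis bounded_iff real_norm_def)
  have "\<bar>a\<bar> \<le> R + measure M (space M) / 2" if "collapse a \<in> S" for a
    using R[OF that] collapse_displacement[of a] by linarith
  then have "bounded (collapse -` S)" by (auto simp: bounded_iff)
  moreover have "closed (collapse -` S)"
    using continuous_on_collapse[of UNIV] compact_imp_closed[OF S]
    by (intro continuous_closed_vimage) (simp_all add: continuous_on_eq_continuous_at)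
  ultimately show ?thesis by (simp add: compact_eq_bounded_closed)
qed

lemma measure_collapse_vimage: "measure lborel (collapse -` S) = measure M (space M)"
  using emeasure_collapse_vimage_inter[of UNIV] sets_eq_imp_space_eq[OF M_is_borel]
  by (simp add: measure_def)

lemma mass_below_spread: "mass_below (collapse -` S) (spread x) = cdf M x"
proof -
  have "{..spread x} = collapse -` {..x}" using collapse_le_iff by auto
  then show ?thesis
    using emeasure_collapse_vimage_inter[of "{..x}"] by (simp add: mass_below_def cdf_def measure_def)
qed

text \<open>At a point of the form \<open>a = spread x\<close> both sides equal \<open>x\<close>, because the mass below \<open>a\<close> is \<open>cdf M x\<close>.
  Any other \<open>a\<close> lies in the fibre over some \<open>x\<close>, to the left of \<open>spread x\<close>. The fibre has length
  equal to the mass of \<open>x\<close>, so \<open>x\<close> belongs to \<open>S\<close> and the fibre to the patch; there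
  the position minus the mass below it is constant.\<close>

lemma particle_path_1_eq_collapse: "particle_path (collapse -` S) a 1 = collapse a"
proof -
  let ?K = "collapse -` S" and ?x = "collapse a"
  have le: "a \<le> spread ?x" using collapse_le_iff by blast
  have fibre: "{a<..spread ?x} \<subseteq> collapse -` {?x}"
    using collapse_le_iff collapse_mono by (force intro: antisym)
  have "a - mass_below ?K a = spread ?x - mass_below ?K (spread ?x)"
  proof (cases "?x \<in> S")
    case True
    then have "?K \<inter> {a<..spread ?x} = {a<..spread ?x}" using fibre by auto
    then show ?thesis using mass_below_diff[OF compact_collapse_vimage le] le by simp
  next
    case False
    have "emeasure M {?x} = emeasure M (S \<inter> {?x})"
      by (subst emeasure_inter_concentration) auto
    then have "emeasure lborel (collapse -` {?x}) = 0"
      using False by (simp add: emeasure_collapse_vimage)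
    then have "emeasure lborel {a<..spread ?x} = 0"
      using emeasure_mono[OF fibre, of lborel] measurable_sets_borel[OF collapse_measurable, of "{?x}"] by simp
    then show ?thesis using le by simp
  qed
  then show ?thesis
    unfolding mass_below_spread by (simp add: particle_path_def measure_collapse_vimage spread_def)
qed

lemma distr_patch_collapse: "distr (patch (collapse -` S)) borel collapse = M"
proof (rule measure_eqI)
  fix A assume "A \<in> sets (distr (patch (collapse -` S)) borel collapse)"
  then have A: "A \<in> sets borel" by simp
  have "emeasure (distr (patch (collapse -` S)) borel collapse) A
      = (\<integral>\<^sup>+ a. ennreal (indicat_real (collapse -` S) a) * indicator (collapse -` A) a \<partial>lborel)"
    using A patch_set_borel[OF compact_collapse_vimage] measurable_sets_borel[OF collapse_measurable A]
    by (simp add: emeasure_distr emeasure_density)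
  also have "\<dots> = (\<integral>\<^sup>+ a. indicator (collapse -` S \<inter> collapse -` A) a \<partial>lborel)"
    by (intro nn_integral_cong) (auto simp: indicator_def)
  also have "\<dots> = emeasure M A"
    using A patch_set_borel[OF compact_collapse_vimage] measurable_sets_borel[OF collapse_measurable A]
    by (simp add: emeasure_collapse_vimage_inter)
  finally show "emeasure (distr (patch (collapse -` S)) borel collapse) A = emeasure M A" .
qed (simp add: M_is_borel)

end

end

theorem theorem3p1:
  fixes K1 :: "real set" and c d L :: real and \<mu>1 :: "real measure"
  assumes "compact K1" and "K1 \<noteq> {}" and "emeasure lborel K1 = 0"
    and "K1 \<subseteq> {c..d}" and "\<And>a b. K1 \<subseteq> {a..b} \<Longrightarrow> {c..d} \<subseteq> {a..b}"
    and "sets \<mu>1 = sets borel" and "finite_measure \<mu>1"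
    and "measure_support \<mu>1 = K1" and "measure \<mu>1 K1 = 2 * L"
  shows "\<exists>K0 :: real set. compact K0 \<and> measure lborel K0 = 2 * L \<and>
    (\<exists>\<rho>. aggregation_solution 1 (indicat_real K0) \<rho>) \<and>
    (\<forall>\<rho>. aggregation_solution 1 (indicat_real K0) \<rho> \<longrightarrow>
      weak_convergence (\<lambda>t. density lborel (\<lambda>x. ennreal (\<rho> x t))) \<mu>1 (at_left 1))"
proof -
  interpret finite_borel_measure \<mu>1
    using assms(6,7) by (simp add: finite_borel_measure_def finite_borel_measure_axioms_def)
  have conc: "emeasure \<mu>1 (- K1) = 0"
    using emeasure_Compl_measure_support[OF assms(6)] assms(8) by simp
  note collapse_facts = assms(1,3) conc
  let ?K0 = "collapse -` K1"
  have "measure \<mu>1 (space \<mu>1) = measure \<mu>1 K1"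
    using emeasure_inter_concentration[OF collapse_facts, of UNIV] sets_eq_imp_space_eq[OF assms(6)]
    by (simp add: measure_def)
  then have "measure lborel ?K0 = 2 * L"
    using measure_collapse_vimage[OF collapse_facts] assms(9) by simp
  moreover have K0: "compact ?K0"
    by (rule compact_collapse_vimage[OF collapse_facts])
  moreover have "weak_convergence (\<lambda>t. density lborel (\<lambda>x. ennreal (\<rho> x t))) \<mu>1 (at_left 1)"
    if "aggregation_solution 1 (indicat_real ?K0) \<rho>" for \<rho>
    using solution_weak_convergence_at_1[OF K0 that] distr_patch_collapse[OF collapse_facts]
    by (simp add: particle_path_1_eq_collapse[OF collapse_facts])
  ultimately show ?thesis
    using aggregation_solution_patch_solution[OF K0] by blast
qed

end
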